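(* Let $D,d\ge 1$ be integers and let $p(x)=\sum_{|\mathbf n|\le d}p_{\mathbf n}x^{\mathbf n}$ be a real polynomial in $D$ variables of degree at most $d$. Consider the problem $$\text{(R)}\qquad \min_{\mu}\ \sum_{\mathbf n\in\mathrm{supp}(p)}p_{\mathbf n}\,\phi_{\mathbf n}(\mu),\qquad \phi_{\mathbf n}(\mu):=\sum_{l=1}^2\prod_{i=1}^D\mu^{(l)}_{i,\mathbf n_i},$$ over all $\mu=\{(\mu^{(l)}_1,\dots,\mu^{(l)}_D)\}_{l=1}^2\in\mathbb R^{(2d+1)\times D\times 2}$ satisfying $\mathcal M_d(\mu_i^{(l)})\succeq 0$ and $\mathcal M_{d-1}(\mu_i^{(l)};1-x_i^2)\succeq 0$ for all $i=1,\dots,D$ and $l=1,2$, and $\phi_{(0,\dots,0)}(\mu)=1$. Let $\mu=\{(\mu^{(l)}_1,\dots,\mu^{(l)}_D)\}_{l=1}^2$ be a feasible point of (R), and put $\alpha^{(l)}:=\prod_{i=1}^D\mu^{(l)}_{i,0}$. Then $\mu$ is a global minimum of (R) if and only if, for every $l\in\{1,2\}$ with $\alpha^{(l)}\neq0$, the point $$\left\{\left(\frac{\mu_1^{(l)}}{\alpha^{(l)}},\mu_2^{(l)},\dots,\mu_D^{(l)}\right),\ (0,\dots,0)\right\}$$ is a local minimum of (R).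
   Context: Multi-indices are $\mathbf n=(\mathbf n_1,\dots,\mathbf n_D)$ with nonnegative integer entries, $|\mathbf n|=\sum_i\mathbf n_i$, $x^{\mathbf n}=\prod_i x_i^{\mathbf n_i}$, and $\mathrm{supp}(p)=\{\mathbf n: p_{\mathbf n}\neq 0\}$. Each $\mu_i^{(l)}=(\mu^{(l)}_{i,0},\dots,\mu^{(l)}_{i,2d})\in\mathbb R^{2d+1}$ is a real vector. For a vector $\nu=(\nu_0,\dots,\nu_{2d})\in\mathbb R^{2d+1}$: $\mathcal M_d(\nu)$ is the $(d+1)\times(d+1)$ matrix with entries $[\mathcal M_d(\nu)]_{m,n}=\nu_{m+n}$, $0\le m,n\le d$; and $\mathcal M_{d-1}(\nu;1-x^2)$ is the $d\times d$ matrix with entries $\nu_{m+n}-\nu_{m+n+2}$, $0\le m,n\le d-1$. $A\succeq0$ means that $A$ is positive semi-definite. In the displayed point, the first $D$-tuple is the $l=1$ block and the second tuple, consisting of $D$ zero vectors of $\mathbb R^{2d+1}$, is the $l=2$ block. A local minimum of (R) is a feasible point having a Euclidean neighbourhood in $\mathbb R^{(2d+1)\times D\times 2}$ such that no feasible point in it has a strictly smaller objective value; a global minimum is a feasible point with smallest objective value among all feasible points. *)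

theory Defs
  imports Complex_Main "HOL-Library.FuncSet" "HOL-Library.Poly_Mapping"
    "Jordan_Normal_Form.Matrix"
begin

text \<open>
  A multi-index is a finitely supported \<open>nat \<Rightarrow>\<^sub>0 nat\<close>, and a real polynomial is a finitely
  supported coefficient function \<open>(nat \<Rightarrow>\<^sub>0 nat) \<Rightarrow>\<^sub>0 real\<close>; its support is \<open>Poly_Mapping.keys p\<close>.
  Variables are numbered \<open>1, \<dots>, D\<close>.
\<close>

definition poly_of_degree_le :: "nat \<Rightarrow> nat \<Rightarrow> ((nat \<Rightarrow>\<^sub>0 nat) \<Rightarrow>\<^sub>0 real) \<Rightarrow> bool" where
  "poly_of_degree_le D d p \<longleftrightarrow>
     (\<forall>n \<in> Poly_Mapping.keys p. Poly_Mapping.keys n \<subseteq> {1..D} \<and>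
        (\<Sum>i = 1..D. poly_mapping.lookup n i) \<le> d)"

definition pos_semidef :: "real mat \<Rightarrow> bool" where
  "pos_semidef A \<longleftrightarrow> square_mat A \<and> transpose_mat A = A \<and>
     (\<forall>v \<in> carrier_vec (dim_row A). 0 \<le> v \<bullet> (A *\<^sub>v v))"

definition moment_mat :: "nat \<Rightarrow> real vec \<Rightarrow> real mat" where
  "moment_mat d \<nu> = mat (d + 1) (d + 1) (\<lambda>(m, n). \<nu> $ (m + n))"

text \<open>
  The localizing matrix of \<open>1 - x\<^sup>2\<close> of order \<open>d - 1\<close>; the argument is \<open>d\<close>, its size.
\<close>

definition localizing_mat :: "nat \<Rightarrow> real vec \<Rightarrow> real mat" where
  "localizing_mat d \<nu> = mat d d (\<lambda>(m, n). \<nu> $ (m + n) - \<nu> $ (m + n + 2))"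

text \<open>
  A point \<open>\<mu>\<close> is applied as \<open>\<mu> l i\<close>, with block \<open>l \<in> {1, 2}\<close> and variable \<open>i \<in> {1..D}\<close>. The
  extensional function space makes points equal iff all their coordinates are.
\<close>

type_synonym point = "nat \<Rightarrow> nat \<Rightarrow> real vec"

definition points :: "nat \<Rightarrow> nat \<Rightarrow> point set" where
  "points D d = {1, 2} \<rightarrow>\<^sub>E ({1..D} \<rightarrow>\<^sub>E carrier_vec (2 * d + 1))"

definition euclid_dist :: "nat \<Rightarrow> nat \<Rightarrow> point \<Rightarrow> point \<Rightarrow> real" where
  "euclid_dist D d \<mu> \<nu> =
     sqrt (\<Sum>l \<in> {1, 2}. \<Sum>i = 1..D. \<Sum>k = 0..2 * d. (\<mu> l i $ k - \<nu> l i $ k)\<^sup>2)"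

definition phi :: "nat \<Rightarrow> (nat \<Rightarrow>\<^sub>0 nat) \<Rightarrow> point \<Rightarrow> real" where
  "phi D n \<mu> = (\<Sum>l \<in> {1, 2}. \<Prod>i = 1..D. \<mu> l i $ poly_mapping.lookup n i)"

definition objective :: "nat \<Rightarrow> ((nat \<Rightarrow>\<^sub>0 nat) \<Rightarrow>\<^sub>0 real) \<Rightarrow> point \<Rightarrow> real" where
  "objective D p \<mu> = (\<Sum>n \<in> Poly_Mapping.keys p. poly_mapping.lookup p n * phi D n \<mu>)"

definition feasible :: "nat \<Rightarrow> nat \<Rightarrow> point \<Rightarrow> bool" where
  "feasible D d \<mu> \<longleftrightarrow> \<mu> \<in> points D d \<and>
     (\<forall>l \<in> {1, 2}. \<forall>i \<in> {1..D}.
        pos_semidef (moment_mat d (\<mu> l i)) \<and> pos_semidef (localizing_mat d (\<mu> l i))) \<and>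
     phi D 0 \<mu> = 1"

definition global_minimum ::
    "nat \<Rightarrow> nat \<Rightarrow> ((nat \<Rightarrow>\<^sub>0 nat) \<Rightarrow>\<^sub>0 real) \<Rightarrow> point \<Rightarrow> bool" where
  "global_minimum D d p \<mu> \<longleftrightarrow> feasible D d \<mu> \<and>
     (\<forall>\<nu>. feasible D d \<nu> \<longrightarrow> objective D p \<mu> \<le> objective D p \<nu>)"

definition local_minimum ::
    "nat \<Rightarrow> nat \<Rightarrow> ((nat \<Rightarrow>\<^sub>0 nat) \<Rightarrow>\<^sub>0 real) \<Rightarrow> point \<Rightarrow> bool" where
  "local_minimum D d p \<mu> \<longleftrightarrow> feasible D d \<mu> \<and>
     (\<exists>\<epsilon> > 0. \<forall>\<nu>. feasible D d \<nu> \<and> euclid_dist D d \<nu> \<mu> < \<epsilon> \<longrightarrow>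
        \<not> objective D p \<nu> < objective D p \<mu>)"

definition alpha :: "nat \<Rightarrow> point \<Rightarrow> nat \<Rightarrow> real" where
  "alpha D \<mu> l = (\<Prod>i = 1..D. \<mu> l i $ 0)"

definition normalized_block :: "nat \<Rightarrow> nat \<Rightarrow> point \<Rightarrow> nat \<Rightarrow> point" where
  "normalized_block D d \<mu> l =
     (\<lambda>m \<in> {1, 2}. \<lambda>i \<in> {1..D}.
        if m = 1 then (if i = 1 then (1 / alpha D \<mu> l) \<cdot>\<^sub>v \<mu> l i else \<mu> l i)
        else 0\<^sub>v (2 * d + 1))"

end

theory Submission
  imports Defs
begin

text \<open>
  A point of the problem is a pair of blocks, and both the objective and the constraint
  \<open>\<phi>\<^sub>0 = 1\<close> are sums over the two blocks of products with one factor per variable. Multiplying the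
  vectors of a block by nonnegative numbers \<open>c\<^sub>i\<close> preserves the semidefinite constraints and
  multiplies the mass of the block (its contribution to \<open>\<phi>\<^sub>0\<close>) and its value (its
  contribution to the objective) by \<open>\<Prod>c\<^sub>i\<close>. Moreover, a block of mass \<open>0\<close> has value \<open>0\<close>
  (lemma \<open>block_value_eq_0\<close>). Hence the objective of a feasible point is the average, with
  weights \<open>\<alpha>\<^sup>(\<^sup>1\<^sup>)\<close> and \<open>\<alpha>\<^sup>(\<^sup>2\<^sup>)\<close>, of the objectives of its normalized blocks of nonzero
  weight.

  If the point is a global minimum, an average of numbers that are at least the minimum equals the
  minimum, so every normalized block of nonzero weight is a global, hence local, minimum.

  Conversely, the empty second block of a normalized point leaves room for any competitor.
  Let \<open>\<beta>\<close> be the normalized block and \<open>\<gamma>\<close> any block of mass \<open>1\<close>. Take a mass \<open>t\<close> away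
  from \<open>\<beta>\<close> and give it to a second block \<open>(t\<^bsup>1/D\<^esup> \<gamma>\<^sub>1, \<dots>, t\<^bsup>1/D\<^esup> \<gamma>\<^sub>D)\<close>. Because the factor \<open>t\<close> is
  spread over all \<open>D\<close> vectors, this point tends to the normalized point as \<open>t\<close> tends to \<open>0\<close>,
  while its objective moves linearly from the value of \<open>\<beta>\<close> towards that of \<open>\<gamma>\<close>. So a local
  minimum has value at most that of every \<open>\<gamma>\<close> (lemma \<open>local_minimum_imp_value_per_mass_le\<close>),
  and averaging over the blocks of two feasible points gives global minimality.
\<close>

section \<open>Moment vectors and semidefiniteness\<close>

lemma pos_semidef_smult:
  assumes "pos_semidef A" "0 \<le> c"
  shows "pos_semidef (c \<cdot>\<^sub>m A)"
proof -
  obtain n where n: "dim_row A = n" by simp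
  have A: "A \<in> carrier_mat n n" and tr: "transpose_mat A = A"
    and pos: "\<And>v. v \<in> carrier_vec n \<Longrightarrow> 0 \<le> v \<bullet> (A *\<^sub>v v)"
    using assms(1) n by (auto simp: pos_semidef_def)
  have "0 \<le> v \<bullet> ((c \<cdot>\<^sub>m A) *\<^sub>v v)" if v: "v \<in> carrier_vec n" for v
  proof -
    have "(c \<cdot>\<^sub>m A) *\<^sub>v v = c \<cdot>\<^sub>v (A *\<^sub>v v)"
      using A v by (intro eq_vecI) auto
    moreover have "v \<bullet> (c \<cdot>\<^sub>v (A *\<^sub>v v)) = c * (v \<bullet> (A *\<^sub>v v))"
      using v n by (intro scalar_prod_smult_right) simp
    ultimately show ?thesis using pos[OF v] assms(2) by simp
  qed
  moreover have "transpose_mat (c \<cdot>\<^sub>m A) = c \<cdot>\<^sub>m transpose_mat A"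
    by (intro eq_matI) auto
  ultimately show ?thesis
    using A by (simp add: pos_semidef_def tr)
qed

lemma unit_vec_scalar_prod_mult_mat:
  assumes "A \<in> carrier_mat n n" "i < n" "j < n"
  shows "unit_vec n i \<bullet> (A *\<^sub>v unit_vec n j) = (A $$ (i, j) :: real)"
  using assms by (simp add: scalar_prod_left_unit[of _ n])

lemma pos_semidef_diag_nonneg:
  assumes "pos_semidef A" "i < dim_row A"
  shows "0 \<le> A $$ (i, i)"
proof -
  have A: "A \<in> carrier_mat (dim_row A) (dim_row A)"
    using assms(1) by (auto simp: pos_semidef_def)
  show ?thesis
    using assms unit_vec_scalar_prod_mult_mat[OF A assms(2) assms(2)]
    by (metis pos_semidef_def unit_vec_carrier)
qed

lemma pos_semidef_zero_diag_imp_zero_row: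
  assumes psd: "pos_semidef A" and i: "i < dim_row A" and j: "j < dim_row A"
    and zero: "A $$ (i, i) = 0"
  shows "A $$ (i, j) = 0"
proof (rule ccontr)
  assume a: "A $$ (i, j) \<noteq> 0"
  obtain n where n: "dim_row A = n" by simp
  let ?ei = "unit_vec n i :: real vec" and ?ej = "unit_vec n j :: real vec"
  have A: "A \<in> carrier_mat n n"
    using psd n by (auto simp: pos_semidef_def)
  have ij: "i < n" "j < n" using i j n by simp_all
  have "A $$ (j, i) = transpose_mat A $$ (i, j)"
    using A ij by simp
  then have sym: "A $$ (j, i) = A $$ (i, j)"
    using psd by (simp add: pos_semidef_def)
  (* The quadratic form at s e_i + e_j is 2 s A_ij + A_jj; this s makes it equal to -1. *)
  define s where "s = - (A $$ (j, j) + 1) / (2 * A $$ (i, j))"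
  let ?v = "s \<cdot>\<^sub>v ?ei + ?ej"
  have "?v \<bullet> (A *\<^sub>v ?v) = s * (s * A $$ (i, i) + A $$ (i, j)) + (s * A $$ (j, i) + A $$ (j, j))"
  proof -
    have Av: "A *\<^sub>v ?v = s \<cdot>\<^sub>v (A *\<^sub>v ?ei) + A *\<^sub>v ?ej"
      by (simp only: mult_add_distrib_mat_vec[OF A] mult_mat_vec[OF A] smult_carrier_vec
          unit_vec_carrier)
    have c: "A *\<^sub>v ?ei \<in> carrier_vec n" "A *\<^sub>v ?ej \<in> carrier_vec n"
      using A by (auto intro: mult_mat_vec_carrier)
    have "u \<bullet> (A *\<^sub>v ?v) = s * (u \<bullet> (A *\<^sub>v ?ei)) + u \<bullet> (A *\<^sub>v ?ej)"
      if "u \<in> carrier_vec n" for u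
      unfolding Av using that c by (simp add: scalar_prod_add_distrib[of u n])
    moreover have "?v \<bullet> w = s * (?ei \<bullet> w) + ?ej \<bullet> w" if "w \<in> carrier_vec n" for w
      using that by (simp add: add_scalar_prod_distrib[of _ n] del: scalar_prod_left_unit)
    moreover have "A *\<^sub>v ?v \<in> carrier_vec n"
      using A by (auto intro: mult_mat_vec_carrier)
    ultimately show ?thesis
      by (simp only: unit_vec_scalar_prod_mult_mat[OF A] ij unit_vec_carrier)
  qed
  also have "\<dots> = - 1"
    using a by (simp add: zero sym s_def field_simps)
  finally have "?v \<bullet> (A *\<^sub>v ?v) < 0" by simp
  moreover have "0 \<le> ?v \<bullet> (A *\<^sub>v ?v)"
    using psd n by (simp add: pos_semidef_def)
  ultimately show False by simp
qed

definition moment_vec :: "nat \<Rightarrow> real vec \<Rightarrow> bool" where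
  "moment_vec d \<nu> \<longleftrightarrow> \<nu> \<in> carrier_vec (2 * d + 1) \<and>
     pos_semidef (moment_mat d \<nu>) \<and> pos_semidef (localizing_mat d \<nu>)"

lemma moment_vec_smult:
  assumes "moment_vec d \<nu>" "0 \<le> c"
  shows "moment_vec d (c \<cdot>\<^sub>v \<nu>)"
proof -
  have \<nu>: "\<nu> \<in> carrier_vec (2 * d + 1)" using assms(1) by (simp add: moment_vec_def)
  have "moment_mat d (c \<cdot>\<^sub>v \<nu>) = c \<cdot>\<^sub>m moment_mat d \<nu>"
    using \<nu> by (intro eq_matI) (auto simp: moment_mat_def)
  moreover have "localizing_mat d (c \<cdot>\<^sub>v \<nu>) = c \<cdot>\<^sub>m localizing_mat d \<nu>"
    using \<nu> by (intro eq_matI) (auto simp: localizing_mat_def right_diff_distrib)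
  ultimately show ?thesis
    using assms by (simp add: moment_vec_def pos_semidef_smult)
qed

lemma moment_vec_mass_nonneg: "moment_vec d \<nu> \<Longrightarrow> 0 \<le> \<nu> $ 0"
  using pos_semidef_diag_nonneg[of "moment_mat d \<nu>" 0] by (simp add: moment_vec_def moment_mat_def)

text \<open>
  The moments of order at most \<open>d\<close> form the first row of the moment matrix, and the mass is the
  diagonal entry of that row.
\<close>

lemma moment_vec_zero_mass:
  assumes "moment_vec d \<nu>" "\<nu> $ 0 = 0" "k \<le> d"
  shows "\<nu> $ k = 0"
  using pos_semidef_zero_diag_imp_zero_row[of "moment_mat d \<nu>" 0 k] assms
  by (simp add: moment_vec_def moment_mat_def)

section \<open>Blocks\<close>

definition block :: "nat \<Rightarrow> nat \<Rightarrow> (nat \<Rightarrow> real vec) \<Rightarrow> bool" where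
  "block D d \<beta> \<longleftrightarrow> \<beta> \<in> extensional {1..D} \<and> (\<forall>i \<in> {1..D}. moment_vec d (\<beta> i))"

definition block_mass :: "nat \<Rightarrow> (nat \<Rightarrow> real vec) \<Rightarrow> real" where
  "block_mass D \<beta> = (\<Prod>i = 1..D. \<beta> i $ 0)"

definition block_value :: "nat \<Rightarrow> ((nat \<Rightarrow>\<^sub>0 nat) \<Rightarrow>\<^sub>0 real) \<Rightarrow> (nat \<Rightarrow> real vec) \<Rightarrow> real" where
  "block_value D p \<beta> = (\<Sum>n \<in> Poly_Mapping.keys p.
     poly_mapping.lookup p n * (\<Prod>i = 1..D. \<beta> i $ poly_mapping.lookup n i))"

definition scale_block :: "nat \<Rightarrow> (nat \<Rightarrow> real) \<Rightarrow> (nat \<Rightarrow> real vec) \<Rightarrow> nat \<Rightarrow> real vec" where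
  "scale_block D c \<beta> = (\<lambda>i \<in> {1..D}. c i \<cdot>\<^sub>v \<beta> i)"

definition pair_point :: "(nat \<Rightarrow> real vec) \<Rightarrow> (nat \<Rightarrow> real vec) \<Rightarrow> point" where
  "pair_point \<beta> \<gamma> = (\<lambda>l \<in> {1, 2}. if l = 1 then \<beta> else \<gamma>)"

lemma pair_point_simps [simp]:
  "pair_point \<beta> \<gamma> 1 = \<beta>" "pair_point \<beta> \<gamma> (Suc 0) = \<beta>" "pair_point \<beta> \<gamma> 2 = \<gamma>"
  by (simp_all add: pair_point_def)

lemma block_vec_carrier: "block D d \<beta> \<Longrightarrow> i \<in> {1..D} \<Longrightarrow> dim_vec (\<beta> i) = 2 * d + 1"
  by (simp add: block_def moment_vec_def)

lemma multi_index_entry_le: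
  assumes "poly_of_degree_le D d p" "n \<in> Poly_Mapping.keys p" "i \<in> {1..D}"
  shows "poly_mapping.lookup n i \<le> d"
  using assms member_le_sum[of i "{1..D}" "poly_mapping.lookup n"]
  by (force simp: poly_of_degree_le_def)

lemma block_scale_block:
  "block D d \<beta> \<Longrightarrow> (\<And>i. i \<in> {1..D} \<Longrightarrow> 0 \<le> c i) \<Longrightarrow> block D d (scale_block D c \<beta>)"
  by (simp add: block_def scale_block_def moment_vec_smult)

lemma block_mass_scale_block:
  assumes "block D d \<beta>"
  shows "block_mass D (scale_block D c \<beta>) = (\<Prod>i = 1..D. c i) * block_mass D \<beta>"
  unfolding block_mass_def prod.distrib [symmetric]
  using block_vec_carrier[OF assms] by (intro prod.cong refl) (simp add: scale_block_def)

lemma block_value_scale_block: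
  assumes "poly_of_degree_le D d p" "block D d \<beta>"
  shows "block_value D p (scale_block D c \<beta>) = (\<Prod>i = 1..D. c i) * block_value D p \<beta>"
proof -
  have "(\<Prod>i = 1..D. scale_block D c \<beta> i $ poly_mapping.lookup n i) =
      (\<Prod>i = 1..D. c i) * (\<Prod>i = 1..D. \<beta> i $ poly_mapping.lookup n i)"
    if "n \<in> Poly_Mapping.keys p" for n
  proof -
    have "scale_block D c \<beta> i $ poly_mapping.lookup n i = c i * \<beta> i $ poly_mapping.lookup n i"
      if "i \<in> {1..D}" for i
      using multi_index_entry_le[OF assms(1) \<open>n \<in> _\<close> that] block_vec_carrier[OF assms(2) that] that
      by (simp add: scale_block_def)
    then show ?thesis unfolding prod.distrib [symmetric] by (intro prod.cong refl)
  qed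
  then show ?thesis
    by (simp add: block_value_def sum_distrib_left mult.left_commute cong: sum.cong)
qed

lemma block_mass_nonneg: "block D d \<beta> \<Longrightarrow> 0 \<le> block_mass D \<beta>"
  unfolding block_mass_def block_def by (intro prod_nonneg) (auto intro: moment_vec_mass_nonneg)

text \<open>
  Mass \<open>0\<close> forces some vector of the block to have zero mass; all its moments that a polynomial
  of degree \<open>d\<close> can see then vanish, and they are a factor of every monomial.
\<close>

lemma block_value_eq_0:
  assumes p: "poly_of_degree_le D d p" and \<beta>: "block D d \<beta>" and "block_mass D \<beta> = 0"
  shows "block_value D p \<beta> = 0"
proof -
  obtain i where i: "i \<in> {1..D}" "\<beta> i $ 0 = 0"
    using assms(3) by (auto simp: block_mass_def)
  have "\<beta> i $ poly_mapping.lookup n i = 0" if "n \<in> Poly_Mapping.keys p" for n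
    using \<beta> i multi_index_entry_le[OF p that i(1)] moment_vec_zero_mass
    unfolding block_def by blast
  then have "(\<Prod>i = 1..D. \<beta> i $ poly_mapping.lookup n i) = 0" if "n \<in> Poly_Mapping.keys p" for n
    using i(1) that by (intro prod_zero) blast+
  then show ?thesis unfolding block_value_def by (intro sum.neutral) simp
qed

section \<open>The problem in terms of blocks\<close>

lemma objective_eq: "objective D p \<mu> = block_value D p (\<mu> 1) + block_value D p (\<mu> 2)"
  by (simp add: objective_def phi_def block_value_def sum.distrib distrib_left)

lemma alpha_eq: "alpha D \<mu> l = block_mass D (\<mu> l)"
  by (simp add: alpha_def block_mass_def)

lemma feasible_iff:
  "feasible D d \<mu> \<longleftrightarrow> \<mu> \<in> extensional {1, 2} \<and> block D d (\<mu> 1) \<and> block D d (\<mu> 2) \<and>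
     block_mass D (\<mu> 1) + block_mass D (\<mu> 2) = 1"
  by (auto simp: feasible_def points_def block_def moment_vec_def phi_def block_mass_def PiE_iff)

lemma feasible_pair_point:
  "feasible D d (pair_point \<beta> \<gamma>) \<longleftrightarrow>
     block D d \<beta> \<and> block D d \<gamma> \<and> block_mass D \<beta> + block_mass D \<gamma> = 1"
  by (simp add: feasible_iff) (simp add: pair_point_def)

lemma scale_block_zero:
  assumes "block D d \<beta>"
  shows "scale_block D (\<lambda>_. 0) \<beta> = (\<lambda>i \<in> {1..D}. 0\<^sub>v (2 * d + 1))"
  using block_vec_carrier[OF assms] by (intro ext) (auto simp: scale_block_def intro!: eq_vecI)

text \<open>
  The weights carrying the mass correction on the first vector alone; normalization and the
  removal of a fraction of the mass are both of this form.
\<close>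

definition first_weight :: "real \<Rightarrow> nat \<Rightarrow> real" where
  "first_weight a i = (if i = 1 then a else 1)"

lemma prod_first_weight: "1 \<le> D \<Longrightarrow> (\<Prod>i = 1..D. first_weight a i) = a"
  by (simp add: first_weight_def prod.delta)

text \<open>
  The zero block is written as a multiple of an arbitrary block \<open>\<gamma>\<close>, so that it appears as the
  end of a path of multiples of \<open>\<gamma>\<close>.
\<close>

lemma normalized_block_eq:
  assumes "block D d (\<mu> l)" "block D d \<gamma>"
  shows "normalized_block D d \<mu> l =
    pair_point (scale_block D (first_weight (1 / block_mass D (\<mu> l))) (\<mu> l))
      (scale_block D (\<lambda>_. 0) \<gamma>)"
proof -
  have "scale_block D (first_weight (1 / block_mass D (\<mu> l))) (\<mu> l) =
      (\<lambda>i \<in> {1..D}. if i = 1 then (1 / alpha D \<mu> l) \<cdot>\<^sub>v \<mu> l i else \<mu> l i)"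
    unfolding scale_block_def
    by (intro restrict_ext) (simp add: first_weight_def alpha_eq)
  then show ?thesis
    unfolding scale_block_zero[OF assms(2)] normalized_block_def pair_point_def
    by (intro restrict_ext) simp
qed

lemma normalized_block_feasible_objective:
  assumes D: "1 \<le> D" and p: "poly_of_degree_le D d p" and \<beta>: "block D d (\<mu> l)"
    and a: "0 < block_mass D (\<mu> l)"
  shows "feasible D d (normalized_block D d \<mu> l)"
    and "objective D p (normalized_block D d \<mu> l) = block_value D p (\<mu> l) / block_mass D (\<mu> l)"
proof -
  have "block D d (scale_block D (first_weight (1 / block_mass D (\<mu> l))) (\<mu> l))"
    using \<beta> a by (intro block_scale_block) (auto simp: first_weight_def)
  moreover have "block D d (scale_block D (\<lambda>_. 0) (\<mu> l))"
    using \<beta> by (intro block_scale_block) auto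
  ultimately show "feasible D d (normalized_block D d \<mu> l)"
    using a D by (simp add: normalized_block_eq[where \<mu> = \<mu> and l = l, OF \<beta> \<beta>] feasible_pair_point
        block_mass_scale_block[OF \<beta>] prod_first_weight del: One_nat_def)
  show "objective D p (normalized_block D d \<mu> l) = block_value D p (\<mu> l) / block_mass D (\<mu> l)"
    using D by (simp add: normalized_block_eq[where \<mu> = \<mu> and l = l, OF \<beta> \<beta>] objective_eq
        block_value_scale_block[OF p \<beta>] prod_first_weight del: One_nat_def)
qed

section \<open>Moving mass to the empty block\<close>

lemma tendsto_euclid_dist_pair_scale_block:
  assumes \<beta>: "block D d \<beta>" and \<gamma>: "block D d \<gamma>"
    and b: "\<And>i. ((\<lambda>t. b t i) \<longlongrightarrow> b0 i) F" and c: "\<And>i. ((\<lambda>t. c t i) \<longlongrightarrow> c0 i) F"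
  shows "((\<lambda>t. euclid_dist D d
      (pair_point (scale_block D (b t) \<beta>) (scale_block D (c t) \<gamma>))
      (pair_point (scale_block D b0 \<beta>) (scale_block D c0 \<gamma>))) \<longlongrightarrow> 0) F"
proof -
  have entry: "(\<Sum>i = 1..D. \<Sum>k = 0..2 * d.
        (scale_block D x \<delta> i $ k - scale_block D x' \<delta> i $ k)\<^sup>2) =
      (\<Sum>i = 1..D. \<Sum>k = 0..2 * d. ((x i - x' i) * \<delta> i $ k)\<^sup>2)"
    if "block D d \<delta>" for \<delta> x x'
    using block_vec_carrier[OF that]
    by (intro sum.cong refl) (simp add: scale_block_def left_diff_distrib)
  have "((\<lambda>t. \<Sum>i = 1..D. \<Sum>k = 0..2 * d. ((x t i - x' i) * \<delta> i $ k)\<^sup>2) \<longlongrightarrow>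
      (\<Sum>i = 1..D. \<Sum>k = 0..2 * d. ((x' i - x' i) * \<delta> i $ k)\<^sup>2)) F"
    if "\<And>i. ((\<lambda>t. x t i) \<longlongrightarrow> x' i) F" for x x' and \<delta> :: "nat \<Rightarrow> real vec"
    by (intro tendsto_intros that)
  from this[OF b, where \<delta> = \<beta>] this[OF c, where \<delta> = \<gamma>]
  have "((\<lambda>t. sqrt ((\<Sum>i = 1..D. \<Sum>k = 0..2 * d. ((b t i - b0 i) * \<beta> i $ k)\<^sup>2) +
      (\<Sum>i = 1..D. \<Sum>k = 0..2 * d. ((c t i - c0 i) * \<gamma> i $ k)\<^sup>2))) \<longlongrightarrow> sqrt (0 + 0)) F"
    by (intro tendsto_real_sqrt tendsto_add) simp_all
  then show ?thesis
    unfolding euclid_dist_def by (simp add: entry \<beta> \<gamma> del: One_nat_def)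
qed

text \<open>
  The path of points that moves a fraction \<open>t\<close> of the mass from \<open>\<beta> = \<mu>\<^sup>(\<^sup>l\<^sup>)\<close>
  (normalized) to a multiple of \<open>\<gamma>\<close> changes the objective by \<open>t\<close> times the difference of the two
  values per unit of mass. Local minimality bounds this from below for small \<open>t\<close>, hence the sign
  of the difference. The conclusion is multiplied out, which makes it valid for \<open>\<gamma>\<close> of mass \<open>0\<close>.
\<close>

lemma local_minimum_imp_value_per_mass_le:
  assumes D: "1 \<le> D" and p: "poly_of_degree_le D d p"
    and \<beta>: "block D d (\<mu> l)" and \<gamma>: "block D d \<gamma>" and a: "0 < block_mass D (\<mu> l)"
    and min: "local_minimum D d p (normalized_block D d \<mu> l)"
  shows "block_value D p (\<mu> l) * block_mass D \<gamma> \<le> block_mass D (\<mu> l) * block_value D p \<gamma>"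
proof (cases "block_mass D \<gamma> = 0")
  case True
  then show ?thesis using block_value_eq_0[OF p \<gamma>] by simp
next
  case False
  let ?a = "block_mass D (\<mu> l)" and ?g = "block_mass D \<gamma>"
  have g: "0 < ?g" using False block_mass_nonneg[OF \<gamma>] by simp
  define b where "b t = first_weight ((1 - t) / ?a)" for t
  define c where "c t i = root D (t / ?g)" for t and i :: nat
  define P where "P t = pair_point (scale_block D (b t) (\<mu> l)) (scale_block D (c t) \<gamma>)" for t
  have prod_b: "(\<Prod>i = 1..D. b t i) = (1 - t) / ?a" for t
    using D by (simp add: b_def prod_first_weight del: One_nat_def)
  have prod_c: "(\<Prod>i = 1..D. c t i) = t / ?g" if "0 < t" for t
    using D g that by (simp add: c_def)
  have feas: "feasible D d (P t)" if "0 < t" "t < 1" for t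
  proof -
    have "block D d (scale_block D (b t) (\<mu> l))"
      using that a by (intro block_scale_block[OF \<beta>]) (auto simp: b_def first_weight_def)
    moreover have "block D d (scale_block D (c t) \<gamma>)"
      using that g D by (intro block_scale_block[OF \<gamma>]) (auto simp: c_def)
    ultimately show ?thesis
      using a g that unfolding P_def
      by (simp add: feasible_pair_point block_mass_scale_block[OF \<beta>]
          block_mass_scale_block[OF \<gamma>] prod_b prod_c del: One_nat_def)
  qed
  have obj: "objective D p (P t) =
      (1 - t) * (block_value D p (\<mu> l) / ?a) + t * (block_value D p \<gamma> / ?g)" if "0 < t" for t
    using that unfolding P_def objective_eq
    by (simp add: block_value_scale_block[OF p \<beta>] block_value_scale_block[OF p \<gamma>] prod_b prod_c
        del: One_nat_def)
  have lim: "((\<lambda>t. euclid_dist D d (P t) (normalized_block D d \<mu> l)) \<longlongrightarrow> 0) (at_right 0)"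
    unfolding normalized_block_eq[where \<mu> = \<mu> and l = l, OF \<beta> \<gamma>] P_def
  proof (rule tendsto_euclid_dist_pair_scale_block[OF \<beta> \<gamma>])
    have "((\<lambda>t. (1 - t) / ?a) \<longlongrightarrow> (1 - 0) / ?a) (at_right 0)"
      using a by (intro tendsto_intros) auto
    then show "((\<lambda>t. b t i) \<longlongrightarrow> first_weight (1 / ?a) i) (at_right 0)" for i
      by (simp add: b_def first_weight_def)
    have "((\<lambda>t. root D (t / ?g)) \<longlongrightarrow> root D (0 / ?g)) (at_right 0)"
      using g by (intro tendsto_intros) auto
    then show "((\<lambda>t. c t i) \<longlongrightarrow> 0) (at_right 0)" for i
      by (simp add: c_def)
  qed
  obtain \<epsilon> where "0 < \<epsilon>" and \<epsilon>: "\<And>\<nu>. feasible D d \<nu> \<Longrightarrow>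
      euclid_dist D d \<nu> (normalized_block D d \<mu> l) < \<epsilon> \<Longrightarrow>
      objective D p (normalized_block D d \<mu> l) \<le> objective D p \<nu>"
    using min by (auto simp: local_minimum_def not_less)
  have "\<forall>\<^sub>F t in at_right 0. euclid_dist D d (P t) (normalized_block D d \<mu> l) < \<epsilon> \<and> t < 1 \<and> 0 < t"
    using order_tendstoD(2)[OF lim \<open>0 < \<epsilon>\<close>] eventually_at_right_less[of "0 :: real"]
      eventually_at_right_real[of 0 "1 :: real"]
    by (auto elim: eventually_elim2 simp: eventually_conj_iff)
  then obtain t where t: "euclid_dist D d (P t) (normalized_block D d \<mu> l) < \<epsilon>" "t < 1" "0 < t"
    using eventually_happens[of _ "at_right (0 :: real)"] by auto
  have "block_value D p (\<mu> l) / ?a \<le>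
      (1 - t) * (block_value D p (\<mu> l) / ?a) + t * (block_value D p \<gamma> / ?g)"
    using \<epsilon>[OF feas t(1)] t
    by (simp add: obj normalized_block_feasible_objective(2)[where \<mu> = \<mu> and l = l, OF D p \<beta> a])
  then have "t * (block_value D p (\<mu> l) / ?a) \<le> t * (block_value D p \<gamma> / ?g)"
    unfolding left_diff_distrib by linarith
  then have "block_value D p (\<mu> l) / ?a \<le> block_value D p \<gamma> / ?g"
    using t(3) by (simp only: mult_le_cancel_left_pos)
  then show ?thesis using a g by (simp add: field_simps)
qed

section \<open>Global minima\<close>

theorem theorem2p3:
  fixes D d :: nat
    and p :: "(nat \<Rightarrow>\<^sub>0 nat) \<Rightarrow>\<^sub>0 real"
    and \<mu> :: point
  assumes "D \<ge> 1" and "d \<ge> 1"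
    and "poly_of_degree_le D d p"
    and "feasible D d \<mu>"
  shows "global_minimum D d p \<mu> \<longleftrightarrow>
    (\<forall>l \<in> {1, 2}. alpha D \<mu> l \<noteq> 0 \<longrightarrow> local_minimum D d p (normalized_block D d \<mu> l))"
proof
  note p = \<open>poly_of_degree_le D d p\<close>
  let ?V = "\<lambda>l. block_value D p (\<mu> l)" and ?a = "\<lambda>l. block_mass D (\<mu> l)"
  have blk: "block D d (\<mu> l)" if "l \<in> {1, 2}" for l
    using that \<open>feasible D d \<mu>\<close> by (auto simp: feasible_iff)
  have sum1: "?a 1 + ?a 2 = 1"
    using \<open>feasible D d \<mu>\<close> by (simp add: feasible_iff)
  have pos: "0 < ?a l" if "l \<in> {1, 2}" "?a l \<noteq> 0" for l
    using block_mass_nonneg[OF blk[OF that(1)]] that(2) by simp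
  show "\<forall>l \<in> {1, 2}. alpha D \<mu> l \<noteq> 0 \<longrightarrow> local_minimum D d p (normalized_block D d \<mu> l)"
    if "global_minimum D d p \<mu>"
  proof (intro ballI impI)
    fix l assume l: "l \<in> {1 :: nat, 2}" and "alpha D \<mu> l \<noteq> 0"
    then have al: "0 < ?a l" using pos by (simp add: alpha_eq)
    let ?M = "objective D p \<mu>"
    have min: "?M \<le> objective D p \<nu>" if "feasible D d \<nu>" for \<nu>
      using \<open>global_minimum D d p \<mu>\<close> that by (simp add: global_minimum_def)
    have le: "?M * ?a m \<le> ?V m" if m: "m \<in> {1, 2}" for m
    proof (cases "?a m = 0")
      case True
      then show ?thesis using block_value_eq_0[OF p blk[OF m]] by simp
    next
      case False
      note nb = normalized_block_feasible_objective[where \<mu> = \<mu> and l = m, OF \<open>D \<ge> 1\<close> p blk[OF m] pos[OF m False]]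
      show ?thesis using min[OF nb(1)] pos[OF m False] by (simp add: nb(2) pos_le_divide_eq)
    qed
    (* The bounds for the two blocks add up to an equality, so each of them is one. *)
    have "?M * ?a 1 + ?M * ?a 2 = ?V 1 + ?V 2"
      using sum1 objective_eq[of D p \<mu>] by (metis distrib_left mult.right_neutral)
    then have "?V l = ?M * ?a l" using le[of 1] le[of 2] l by auto
    then have "objective D p (normalized_block D d \<mu> l) = ?M"
      using normalized_block_feasible_objective(2)[where \<mu> = \<mu> and l = l, OF \<open>D \<ge> 1\<close> p blk[OF l] al]
        al by simp
    then show "local_minimum D d p (normalized_block D d \<mu> l)"
      using normalized_block_feasible_objective(1)[where \<mu> = \<mu> and l = l, OF \<open>D \<ge> 1\<close> p blk[OF l] al]
        min by (auto simp: local_minimum_def not_less intro!: exI[of _ 1])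
  qed
  show "global_minimum D d p \<mu>"
    if loc: "\<forall>l \<in> {1, 2}. alpha D \<mu> l \<noteq> 0 \<longrightarrow> local_minimum D d p (normalized_block D d \<mu> l)"
    unfolding global_minimum_def
  proof (intro conjI allI impI)
    fix \<nu> assume \<nu>: "feasible D d \<nu>"
    have sum\<nu>: "block_mass D (\<nu> 1) + block_mass D (\<nu> 2) = 1"
      using \<nu> by (simp add: feasible_iff)
    have le: "?V l \<le> ?a l * objective D p \<nu>" if l: "l \<in> {1, 2}" for l
    proof (cases "?a l = 0")
      case True
      then show ?thesis using block_value_eq_0[OF p blk[OF l]] by simp
    next
      case False
      then have lm: "local_minimum D d p (normalized_block D d \<mu> l)"
        using loc l by (auto simp: alpha_eq)
      have "?V l * block_mass D (\<nu> m) \<le> ?a l * block_value D p (\<nu> m)" if m: "m \<in> {1, 2}" for m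
        using local_minimum_imp_value_per_mass_le[where \<mu> = \<mu> and l = l, OF \<open>D \<ge> 1\<close> p blk[OF l] _ pos[OF l False] lm] \<nu> m
        by (auto simp: feasible_iff)
      from add_mono[OF this[of 1] this[of 2]] show ?thesis
        unfolding objective_eq distrib_left [symmetric] sum\<nu> by simp
    qed
    have "objective D p \<mu> \<le> (?a 1 + ?a 2) * objective D p \<nu>"
      using le[of 1] le[of 2] by (simp add: objective_eq[of D p \<mu>] distrib_right)
    then show "objective D p \<mu> \<le> objective D p \<nu>" unfolding sum1 by simp
  qed (fact \<open>feasible D d \<mu>\<close>)
qed

end
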